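(* Let $\mathbf{k}$ be a field, $\lambda\in\mathbf{k}$, let $(\mathfrak{g},P_{\mathfrak{g}})$ be a Rota-Baxter Lie algebra of weight $\lambda$, $E$ a vector space containing $\mathfrak{g}$ as a subspace, and $V$ a complement of $\mathfrak{g}$ in $E$. Then: (a) The relation $\equiv$ (defined in the context) is an equivalence relation on the set $\mathcal{L}((\mathfrak{g},P_{\mathfrak{g}}),V)$ of all Rota-Baxter Lie extending structures of $(\mathfrak{g},P_{\mathfrak{g}})$ through $V$. Denote the quotient set by $H^2_{(\mathfrak{g},P_{\mathfrak{g}})}(V,(\mathfrak{g},P_{\mathfrak{g}})):=\mathcal{L}((\mathfrak{g},P_{\mathfrak{g}}),V)/\equiv$. (b) The map $$\Phi:H^2_{(\mathfrak{g},P_{\mathfrak{g}})}(V,(\mathfrak{g},P_{\mathfrak{g}}))\to Extd(E,(\mathfrak{g},P_{\mathfrak{g}})),\qquad \overline{(\triangleleft,\triangleright,f,\{-,-\},P_1,P_2)}\mapsto(\mathfrak{g}\natural V,[-,-],\mathcal{P})$$ is a (well-defined) bijection, where $\overline{(\triangleleft,\triangleright,f,\{-,-\},P_1,P_2)}$ is the equivalence class of $(\triangleleft,\triangleright,f,\{-,-\},P_1,P_2)$ via $\equiv$, and the unified product $(\mathfrak{g}\natural V,[-,-],\mathcal{P})$ stands for the class in $Extd(E,(\mathfrak{g},P_{\mathfrak{g}}))$ of the Rota-Baxter Lie algebra structure on $E$ obtained by transporting it along the linear isomorphism $\mathfrak{g}\times V\to E$, $(g,x)\mapsto g+x$.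
   Context: All vector spaces, linear and bilinear maps are over the field $\mathbf{k}$; $\lambda\in\mathbf{k}$ is fixed. A Rota-Baxter Lie algebra (of weight $\lambda$) is a Lie algebra $\mathfrak{g}$ with a linear map $P:\mathfrak{g}\to\mathfrak{g}$ such that $[P(g),P(h)]=P([P(g),h]+[g,P(h)]+\lambda[g,h])$ for all $g,h\in\mathfrak{g}$. A morphism $(\mathfrak{g},P)\to(\mathfrak{g}',P')$ is a Lie algebra morphism $\phi$ with $\phi\circ P=P'\circ\phi$; it is an isomorphism if it is bijective. $(\mathfrak{g},P_{\mathfrak{g}})$ is a Rota-Baxter Lie subalgebra of $(E,[-,-],P_E)$ if $\mathfrak{g}\subseteq E$ is a subspace, the bracket of $E$ restricts to that of $\mathfrak{g}$, and $P_E|_{\mathfrak{g}}=P_{\mathfrak{g}}$. A complement of $\mathfrak{g}$ in $E$ is a subspace $V$ with $E=\mathfrak{g}+V$, $\mathfrak{g}\cap V=0$. $Extd(E,(\mathfrak{g},P_{\mathfrak{g}}))$: the set of equivalence classes of Rota-Baxter Lie algebra structures $([-,-],P)$ on $E$ containing $(\mathfrak{g},P_{\mathfrak{g}})$ as a Rota-Baxter Lie subalgebra, where two structures are equivalent if there is an isomorphism of Rota-Baxter Lie algebras $\phi:(E,[-,-],P)\to(E,[-,-]',P')$ with $\phi(g)=g$ for all $g\in\mathfrak{g}$ (i.e. $\phi$ stabilizes $(\mathfrak{g},P_{\mathfrak{g}})$). Extending datum: an extending datum of $(\mathfrak{g},P_{\mathfrak{g}})$ through $V$ is a system $(\triangleleft,\triangleright,f,\{-,-\},P_1,P_2)$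 of bilinear maps $\triangleleft:V\times\mathfrak{g}\to V$, $\triangleright:V\times\mathfrak{g}\to\mathfrak{g}$, $f:V\times V\to\mathfrak{g}$, $\{-,-\}:V\times V\to V$ and linear maps $P_1:V\to\mathfrak{g}$, $P_2:V\to V$. Given such a datum, $\mathfrak{g}\natural V$ denotes the vector space $\mathfrak{g}\times V$ with $$[(g,x),(h,y)]:=([g,h]+x\triangleright h-y\triangleright g+f(x,y),\ \{x,y\}+x\triangleleft h-y\triangleleft g),$$ $$\mathcal{P}((g,x)):=(P_{\mathfrak{g}}(g)+P_1(x),\ P_2(x)).$$ The datum is a Rota-Baxter Lie extending structure if $\mathfrak{g}\natural V$ with these maps is a Rota-Baxter Lie algebra of weight $\lambda$ (the unified product). The relation $\equiv$ on $\mathcal{L}((\mathfrak{g},P_{\mathfrak{g}}),V)$: $(\triangleleft,\triangleright,f,\{-,-\},P_1,P_2)\equiv(\triangleleft',\triangleright',f',\{-,-\}',P_1',P_2')$ if there exist a linear map $r:V\to\mathfrak{g}$ and a linear automorphism $v$ of $V$ such that for all $g\in\mathfrak{g}$, $x,y\in V$, writing $\bar x=v^{-1}(x)$, $\bar y=v^{-1}(y)$: $$x\triangleleft' g=v(\bar x\triangleleft g),$$ $$x\triangleright' g=r(\bar x\triangleleft g)+\bar x\triangleright g+[g,r(\bar x)],$$ $$f'(x,y)=f(\bar x,\bar y)+r(\{\bar x,\bar y\})+[r(\bar x),r(\bar y)]-r(\bar x\triangleleft r(\bar y))-\bar x\triangleright r(\bar y)+r(\bar y\triangleleft r(\bar x))+\bar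 y\triangleright r(\bar x),$$ $$\{x,y\}'=v(\{\bar x,\bar y\})-v(\bar x\triangleleft r(\bar y))+v(\bar y\triangleleft r(\bar x)),$$ $$P_1'(x)=P_1(\bar x)-P_{\mathfrak{g}}(r(\bar x))+r(P_2(\bar x)),\qquad P_2'(x)=v(P_2(\bar x)).$$ *)

theory Defs
  imports "HOL-Library.FuncSet" "HOL-Analysis.Product_Vector"
begin

text \<open>
  A vector space over a field is a type with a scalar multiplication satisfying
  \<^locale>\<open>vector_space\<close>; subspaces are sets. The following are linear and bilinear maps whose
  domains and codomains are subspaces.
\<close>

definition linear_on ::
  "('k \<Rightarrow> 'a \<Rightarrow> 'a) \<Rightarrow> ('k \<Rightarrow> 'b \<Rightarrow> 'b) \<Rightarrow> 'a set \<Rightarrow> 'b set \<Rightarrow> ('a::plus \<Rightarrow> 'b::plus) \<Rightarrow> bool"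
where
  "linear_on s t A B \<phi> \<longleftrightarrow>
     \<phi> \<in> A \<rightarrow> B \<and>
     (\<forall>x\<in>A. \<forall>y\<in>A. \<phi> (x + y) = \<phi> x + \<phi> y) \<and>
     (\<forall>c. \<forall>x\<in>A. \<phi> (s c x) = t c (\<phi> x))"

definition bilinear_on ::
  "('k \<Rightarrow> 'a \<Rightarrow> 'a) \<Rightarrow> 'a set \<Rightarrow> 'a set \<Rightarrow> 'a set \<Rightarrow> ('a::plus \<Rightarrow> 'a \<Rightarrow> 'a) \<Rightarrow> bool"
where
  "bilinear_on s A B C \<beta> \<longleftrightarrow>
     (\<forall>x\<in>A. linear_on s s B C (\<beta> x)) \<and>
     (\<forall>y\<in>B. linear_on s s A C (\<lambda>x. \<beta> x y))"

text \<open>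
  The underlying space is the subspace \<open>A\<close> of the ambient vector space. Values of the bracket
  and of the operator outside \<open>A\<close> are irrelevant. The bracket is alternating, which is the
  right axiom in every characteristic.
\<close>

locale lie_algebra = vector_space smul
  for smul :: "'k::field \<Rightarrow> 'a::ab_group_add \<Rightarrow> 'a" +
  fixes A :: "'a set" and bracket :: "'a \<Rightarrow> 'a \<Rightarrow> 'a"
  assumes subspace_carrier: "subspace A"
    and bilinear_bracket: "bilinear_on smul A A A bracket"
    and bracket_self: "x \<in> A \<Longrightarrow> bracket x x = 0"
    and jacobi: "x \<in> A \<Longrightarrow> y \<in> A \<Longrightarrow> z \<in> A \<Longrightarrow>
      bracket x (bracket y z) + bracket y (bracket z x) + bracket z (bracket x y) = 0"

locale rota_baxter_lie_algebra = lie_algebra smul A bracket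
  for smul :: "'k::field \<Rightarrow> 'a::ab_group_add \<Rightarrow> 'a" and A bracket +
  fixes lam :: 'k and P :: "'a \<Rightarrow> 'a"
  assumes linear_operator: "linear_on smul smul A A P"
    and rota_baxter: "x \<in> A \<Longrightarrow> y \<in> A \<Longrightarrow>
      bracket (P x) (P y) =
        P (bracket (P x) y + bracket x (P y) + smul lam (bracket x y))"

definition rota_baxter_lie_hom ::
  "('k \<Rightarrow> 'a \<Rightarrow> 'a) \<Rightarrow> 'a set \<Rightarrow> ('a \<Rightarrow> 'a \<Rightarrow> 'a) \<Rightarrow> ('a \<Rightarrow> 'a) \<Rightarrow>
   ('k \<Rightarrow> 'b \<Rightarrow> 'b) \<Rightarrow> 'b set \<Rightarrow> ('b \<Rightarrow> 'b \<Rightarrow> 'b) \<Rightarrow> ('b \<Rightarrow> 'b) \<Rightarrow> ('a::plus \<Rightarrow> 'b::plus) \<Rightarrow> bool"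
where
  "rota_baxter_lie_hom s A br P t B br' P' \<phi> \<longleftrightarrow>
     linear_on s t A B \<phi> \<and>
     (\<forall>x\<in>A. \<forall>y\<in>A. \<phi> (br x y) = br' (\<phi> x) (\<phi> y)) \<and>
     (\<forall>x\<in>A. \<phi> (P x) = P' (\<phi> x))"

definition rota_baxter_lie_iso ::
  "('k \<Rightarrow> 'a \<Rightarrow> 'a) \<Rightarrow> 'a set \<Rightarrow> ('a \<Rightarrow> 'a \<Rightarrow> 'a) \<Rightarrow> ('a \<Rightarrow> 'a) \<Rightarrow>
   ('k \<Rightarrow> 'b \<Rightarrow> 'b) \<Rightarrow> 'b set \<Rightarrow> ('b \<Rightarrow> 'b \<Rightarrow> 'b) \<Rightarrow> ('b \<Rightarrow> 'b) \<Rightarrow> ('a::plus \<Rightarrow> 'b::plus) \<Rightarrow> bool"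
where
  "rota_baxter_lie_iso s A br P t B br' P' \<phi> \<longleftrightarrow>
     rota_baxter_lie_hom s A br P t B br' P' \<phi> \<and> bij_betw \<phi> A B"

definition rota_baxter_lie_subalgebra ::
  "('k::field \<Rightarrow> 'a::ab_group_add \<Rightarrow> 'a) \<Rightarrow> 'k \<Rightarrow> 'a set \<Rightarrow> ('a \<Rightarrow> 'a \<Rightarrow> 'a) \<Rightarrow> ('a \<Rightarrow> 'a) \<Rightarrow>
   'a set \<Rightarrow> ('a \<Rightarrow> 'a \<Rightarrow> 'a) \<Rightarrow> ('a \<Rightarrow> 'a) \<Rightarrow> bool"
where
  "rota_baxter_lie_subalgebra smul lam G brG PG A br P \<longleftrightarrow>
     rota_baxter_lie_algebra smul G brG lam PG \<and>
     rota_baxter_lie_algebra smul A br lam P \<and>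
     G \<subseteq> A \<and>
     (\<forall>g\<in>G. \<forall>h\<in>G. br g h = brG g h) \<and>
     (\<forall>g\<in>G. P g = PG g)"

definition complement ::
  "('k::field \<Rightarrow> 'a::ab_group_add \<Rightarrow> 'a) \<Rightarrow> 'a set \<Rightarrow> 'a set \<Rightarrow> bool"
where
  "complement smul G V \<longleftrightarrow>
     module.subspace smul V \<and> (\<forall>e. \<exists>g\<in>G. \<exists>x\<in>V. e = g + x) \<and> G \<inter> V = {0}"

text \<open>The vector space \<open>E\<close> is the whole type; a structure on \<open>E\<close> is a pair (bracket, operator).\<close>

definition extd_structures ::
  "('k::field \<Rightarrow> 'e::ab_group_add \<Rightarrow> 'e) \<Rightarrow> 'k \<Rightarrow> 'e set \<Rightarrow> ('e \<Rightarrow> 'e \<Rightarrow> 'e) \<Rightarrow> ('e \<Rightarrow> 'e) \<Rightarrow>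
   (('e \<Rightarrow> 'e \<Rightarrow> 'e) \<times> ('e \<Rightarrow> 'e)) set"
where
  "extd_structures smul lam G brG PG =
     {(br, P). rota_baxter_lie_subalgebra smul lam G brG PG UNIV br P}"

definition extd_rel ::
  "('k::field \<Rightarrow> 'e::ab_group_add \<Rightarrow> 'e) \<Rightarrow> 'k \<Rightarrow> 'e set \<Rightarrow> ('e \<Rightarrow> 'e \<Rightarrow> 'e) \<Rightarrow> ('e \<Rightarrow> 'e) \<Rightarrow>
   ((('e \<Rightarrow> 'e \<Rightarrow> 'e) \<times> ('e \<Rightarrow> 'e)) \<times> (('e \<Rightarrow> 'e \<Rightarrow> 'e) \<times> ('e \<Rightarrow> 'e))) set"
where
  "extd_rel smul lam G brG PG =
     {((br, P), (br', P')).
        (br, P) \<in> extd_structures smul lam G brG PG \<and>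
        (br', P') \<in> extd_structures smul lam G brG PG \<and>
        (\<exists>\<phi>. rota_baxter_lie_iso smul UNIV br P smul UNIV br' P' \<phi> \<and> (\<forall>g\<in>G. \<phi> g = g))}"

definition Extd ::
  "('k::field \<Rightarrow> 'e::ab_group_add \<Rightarrow> 'e) \<Rightarrow> 'k \<Rightarrow> 'e set \<Rightarrow> ('e \<Rightarrow> 'e \<Rightarrow> 'e) \<Rightarrow> ('e \<Rightarrow> 'e) \<Rightarrow>
   (('e \<Rightarrow> 'e \<Rightarrow> 'e) \<times> ('e \<Rightarrow> 'e)) set set"
where
  "Extd smul lam G brG PG = extd_structures smul lam G brG PG // extd_rel smul lam G brG PG"

lemma rota_baxter_lie_iso_inv:
  assumes "rota_baxter_lie_iso s UNIV br P t UNIV br' P' \<phi>"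
  shows "rota_baxter_lie_iso t UNIV br' P' s UNIV br P (inv \<phi>)"
proof -
  have bij: "bij \<phi>"
    using assms by (simp add: rota_baxter_lie_iso_def)
  have *: "\<phi> (inv \<phi> y) = y" "inv \<phi> (\<phi> x) = x" for x y
    using bij by (auto simp: bij_def surj_f_inv_f)
  have eqI: "inv \<phi> y = x" if "y = \<phi> x" for x y
    using that * by simp
  show ?thesis
    using assms bij_imp_bij_inv[OF bij]
    by (auto simp: rota_baxter_lie_iso_def rota_baxter_lie_hom_def linear_on_def * intro!: eqI)
qed

lemma rota_baxter_lie_iso_comp:
  assumes "rota_baxter_lie_iso s A br P t B br' P' \<phi>"
    and "rota_baxter_lie_iso t B br' P' u C br'' P'' \<psi>"
  shows "rota_baxter_lie_iso s A br P u C br'' P'' (\<psi> \<circ> \<phi>)"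
  using assms
  by (auto simp: rota_baxter_lie_iso_def rota_baxter_lie_hom_def linear_on_def Pi_iff
      intro: bij_betw_trans)

lemma equiv_extd_rel:
  "equiv (extd_structures smul lam G brG PG) (extd_rel smul lam G brG PG)"
proof (rule equivI)
  show "refl_on (extd_structures smul lam G brG PG) (extd_rel smul lam G brG PG)"
    by (auto simp: refl_on_def extd_rel_def rota_baxter_lie_iso_def rota_baxter_lie_hom_def
        linear_on_def intro!: exI[of _ id])
  show "extd_rel smul lam G brG PG \<subseteq>
      extd_structures smul lam G brG PG \<times> extd_structures smul lam G brG PG"
    by (auto simp: extd_rel_def)
  show "sym (extd_rel smul lam G brG PG)"
  proof (rule symI, clarsimp simp: extd_rel_def)
    fix br P br' P' \<phi>
    assume iso: "rota_baxter_lie_iso smul UNIV br P smul UNIV br' P' \<phi>"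
      and stab: "\<forall>g\<in>G. \<phi> g = g"
    have "inj \<phi>"
      using iso by (simp add: rota_baxter_lie_iso_def bij_is_inj)
    then have "\<forall>g\<in>G. inv \<phi> g = g"
      using stab inv_f_eq by metis
    then show "\<exists>\<phi>. rota_baxter_lie_iso smul UNIV br' P' smul UNIV br P \<phi> \<and> (\<forall>g\<in>G. \<phi> g = g)"
      using rota_baxter_lie_iso_inv[OF iso] by blast
  qed
  show "trans (extd_rel smul lam G brG PG)"
  proof (rule transI, clarsimp simp: extd_rel_def)
    fix br P br' P' br'' P'' \<phi> \<psi>
    assume "rota_baxter_lie_iso smul UNIV br P smul UNIV br' P' \<phi>" "\<forall>g\<in>G. \<phi> g = g"
      and "rota_baxter_lie_iso smul UNIV br' P' smul UNIV br'' P'' \<psi>" "\<forall>g\<in>G. \<psi> g = g"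
    then show "\<exists>\<phi>. rota_baxter_lie_iso smul UNIV br P smul UNIV br'' P'' \<phi> \<and> (\<forall>g\<in>G. \<phi> g = g)"
      by (intro exI[of _ "\<psi> \<circ> \<phi>"]) (auto intro: rota_baxter_lie_iso_comp)
  qed
qed

record 'e extending_datum =
  ract :: "'e \<Rightarrow> 'e \<Rightarrow> 'e"    \<comment> \<open>\<open>x \<triangleleft> g\<close>, with values in \<open>V\<close>\<close>
  lact :: "'e \<Rightarrow> 'e \<Rightarrow> 'e"    \<comment> \<open>\<open>x \<triangleright> g\<close>, with values in \<open>G\<close>\<close>
  cocyc :: "'e \<Rightarrow> 'e \<Rightarrow> 'e"   \<comment> \<open>\<open>f\<close>\<close>
  curly :: "'e \<Rightarrow> 'e \<Rightarrow> 'e"   \<comment> \<open>\<open>{-,-}\<close>\<close>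
  op1 :: "'e \<Rightarrow> 'e"
  op2 :: "'e \<Rightarrow> 'e"

text \<open>
  The components are extensional (\<^const>\<open>PiE\<close>), so that two data are equal iff they are equal as
  maps on \<open>G\<close> and \<open>V\<close>.
\<close>

definition extending_data ::
  "('k \<Rightarrow> 'e \<Rightarrow> 'e) \<Rightarrow> 'e set \<Rightarrow> 'e set \<Rightarrow> ('e::ab_group_add) extending_datum set"
where
  "extending_data smul G V =
     {d. ract d \<in> V \<rightarrow>\<^sub>E G \<rightarrow>\<^sub>E V \<and> bilinear_on smul V G V (ract d) \<and>
         lact d \<in> V \<rightarrow>\<^sub>E G \<rightarrow>\<^sub>E G \<and> bilinear_on smul V G G (lact d) \<and>
         cocyc d \<in> V \<rightarrow>\<^sub>E V \<rightarrow>\<^sub>E G \<and> bilinear_on smul V V G (cocyc d) \<and>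
         curly d \<in> V \<rightarrow>\<^sub>E V \<rightarrow>\<^sub>E V \<and> bilinear_on smul V V V (curly d) \<and>
         op1 d \<in> V \<rightarrow>\<^sub>E G \<and> linear_on smul smul V G (op1 d) \<and>
         op2 d \<in> V \<rightarrow>\<^sub>E V \<and> linear_on smul smul V V (op2 d)}"

definition unified_bracket ::
  "('e \<Rightarrow> 'e \<Rightarrow> 'e) \<Rightarrow> ('e::ab_group_add) extending_datum \<Rightarrow> 'e \<times> 'e \<Rightarrow> 'e \<times> 'e \<Rightarrow> 'e \<times> 'e"
where
  "unified_bracket brG d = (\<lambda>(g, x) (h, y).
     (brG g h + lact d x h - lact d y g + cocyc d x y,
      curly d x y + ract d x h - ract d y g))"

definition unified_operator ::
  "('e \<Rightarrow> 'e) \<Rightarrow> ('e::ab_group_add) extending_datum \<Rightarrow> 'e \<times> 'e \<Rightarrow> 'e \<times> 'e"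
where
  "unified_operator PG d = (\<lambda>(g, x). (PG g + op1 d x, op2 d x))"

text \<open>The space \<open>G \<times> V\<close> carries the componentwise scalar multiplication of \<^locale>\<open>module_prod\<close>.\<close>

definition extending_structures ::
  "('k::field \<Rightarrow> 'e::ab_group_add \<Rightarrow> 'e) \<Rightarrow> 'k \<Rightarrow> 'e set \<Rightarrow> ('e \<Rightarrow> 'e \<Rightarrow> 'e) \<Rightarrow> ('e \<Rightarrow> 'e) \<Rightarrow>
   'e set \<Rightarrow> 'e extending_datum set"
where
  "extending_structures smul lam G brG PG V =
     {d \<in> extending_data smul G V.
        rota_baxter_lie_algebra (module_prod.scale smul smul) (G \<times> V)
          (unified_bracket brG d) lam (unified_operator PG d)}"

definition datum_equivalent ::
  "('k \<Rightarrow> 'e \<Rightarrow> 'e) \<Rightarrow> 'e set \<Rightarrow> ('e \<Rightarrow> 'e \<Rightarrow> 'e) \<Rightarrow> ('e \<Rightarrow> 'e) \<Rightarrow> 'e set \<Rightarrow>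
   ('e::ab_group_add) extending_datum \<Rightarrow> 'e extending_datum \<Rightarrow> bool"
where
  "datum_equivalent smul G brG PG V d d' \<longleftrightarrow>
     (\<exists>r v. linear_on smul smul V G r \<and>
            linear_on smul smul V V v \<and> bij_betw v V V \<and>
       (\<forall>g\<in>G. \<forall>x\<in>V. \<forall>y\<in>V.
          let x' = inv_into V v x; y' = inv_into V v y in
            ract d' x g = v (ract d x' g) \<and>
            lact d' x g = r (ract d x' g) + lact d x' g + brG g (r x') \<and>
            cocyc d' x y =
              cocyc d x' y' + r (curly d x' y') + brG (r x') (r y')
              - r (ract d x' (r y')) - lact d x' (r y')
              + r (ract d y' (r x')) + lact d y' (r x') \<and>
            curly d' x y =
              v (curly d x' y') - v (ract d x' (r y')) + v (ract d y' (r x')) \<and>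
            op1 d' x = op1 d x' - PG (r x') + r (op2 d x') \<and>
            op2 d' x = v (op2 d x')))"

definition datum_rel ::
  "('k::field \<Rightarrow> 'e::ab_group_add \<Rightarrow> 'e) \<Rightarrow> 'k \<Rightarrow> 'e set \<Rightarrow> ('e \<Rightarrow> 'e \<Rightarrow> 'e) \<Rightarrow> ('e \<Rightarrow> 'e) \<Rightarrow>
   'e set \<Rightarrow> ('e extending_datum \<times> 'e extending_datum) set"
where
  "datum_rel smul lam G brG PG V =
     {(d, d'). d \<in> extending_structures smul lam G brG PG V \<and>
               d' \<in> extending_structures smul lam G brG PG V \<and>
               datum_equivalent smul G brG PG V d d'}"

definition H2 ::
  "('k::field \<Rightarrow> 'e::ab_group_add \<Rightarrow> 'e) \<Rightarrow> 'k \<Rightarrow> 'e set \<Rightarrow> ('e \<Rightarrow> 'e \<Rightarrow> 'e) \<Rightarrow> ('e \<Rightarrow> 'e) \<Rightarrow>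
   'e set \<Rightarrow> 'e extending_datum set set"
where
  "H2 smul lam G brG PG V =
     extending_structures smul lam G brG PG V // datum_rel smul lam G brG PG V"

definition sum_map :: "'e \<times> 'e \<Rightarrow> 'e::plus"
  where "sum_map = (\<lambda>(g, x). g + x)"

definition transported_structure ::
  "'e set \<Rightarrow> ('e \<Rightarrow> 'e \<Rightarrow> 'e) \<Rightarrow> ('e \<Rightarrow> 'e) \<Rightarrow> 'e set \<Rightarrow> ('e::ab_group_add) extending_datum \<Rightarrow>
   ('e \<Rightarrow> 'e \<Rightarrow> 'e) \<times> ('e \<Rightarrow> 'e)"
where
  "transported_structure G brG PG V d =
     (let \<sigma> = inv_into (G \<times> V) sum_map in
       (\<lambda>a b. sum_map (unified_bracket brG d (\<sigma> a) (\<sigma> b)),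
        \<lambda>a. sum_map (unified_operator PG d (\<sigma> a))))"

definition unified_product_class ::
  "('k::field \<Rightarrow> 'e::ab_group_add \<Rightarrow> 'e) \<Rightarrow> 'k \<Rightarrow> 'e set \<Rightarrow> ('e \<Rightarrow> 'e \<Rightarrow> 'e) \<Rightarrow> ('e \<Rightarrow> 'e) \<Rightarrow>
   'e set \<Rightarrow> 'e extending_datum \<Rightarrow> (('e \<Rightarrow> 'e \<Rightarrow> 'e) \<times> ('e \<Rightarrow> 'e)) set"
where
  "unified_product_class smul lam G brG PG V d =
     extd_rel smul lam G brG PG `` {transported_structure G brG PG V d}"

text \<open>
  As usual for maps on quotients, the value at a class is the union of the values at its members,
  which is the common value if the map on representatives respects the relation.
\<close>

definition Phi ::
  "('k::field \<Rightarrow> 'e::ab_group_add \<Rightarrow> 'e) \<Rightarrow> 'k \<Rightarrow> 'e set \<Rightarrow> ('e \<Rightarrow> 'e \<Rightarrow> 'e) \<Rightarrow> ('e \<Rightarrow> 'e) \<Rightarrow>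
   'e set \<Rightarrow> 'e extending_datum set \<Rightarrow> (('e \<Rightarrow> 'e \<Rightarrow> 'e) \<times> ('e \<Rightarrow> 'e)) set"
where
  "Phi smul lam G brG PG V C = (\<Union>d\<in>C. unified_product_class smul lam G brG PG V d)"

end

theory Submission
  imports Defs
begin

text \<open>
  Transport along \<open>(g, x) \<mapsto> g + x\<close> maps the extending structures onto the structures on \<open>E\<close>
  that contain \<open>G\<close>: a preimage is obtained by splitting bracket and operator into their
  components in \<open>G\<close> and \<open>V\<close>. A linear automorphism of \<open>E\<close> that fixes \<open>G\<close> pointwise has the
  form \<open>g + x \<mapsto> g + r x + v x\<close> with \<open>v\<close> bijective on \<open>V\<close>, and comparing the components of
  the morphism equations at the pairs \<open>(x, g)\<close> and \<open>(x, y)\<close> gives exactly the formulas that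
  define \<open>\<equiv>\<close>. Hence \<open>\<equiv>\<close> is the pullback of the equivalence of structures on \<open>E\<close> along a
  surjection, and the quotients correspond.
\<close>

section \<open>Pulling an equivalence relation back along a map\<close>

lemma equiv_pullback:
  assumes R': "equiv X R'" and T: "T ` S \<subseteq> X"
    and R: "R = {(a, b). a \<in> S \<and> b \<in> S \<and> (T a, T b) \<in> R'}"
  shows "equiv S R"
  using R' T unfolding R equiv_def refl_on_def sym_def trans_def by blast

lemma respects_pullback:
  assumes R': "equiv X R'"
    and R: "R = {(a, b). a \<in> S \<and> b \<in> S \<and> (T a, T b) \<in> R'}"
  shows "(\<lambda>a. R' `` {T a}) respects R"
  using equiv_class_eq[OF R'] unfolding R congruent_def by blast

text \<open>The induced map on classes is injective because \<open>R\<close> relates two points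
  whenever \<open>R'\<close> relates their images, and surjective because \<open>T\<close> maps onto
  \<open>X\<close>. It is written as a union over the class, which is the form of
  \<open>Phi\<close>.\<close>

lemma bij_betw_quotient_pullback:
  assumes R': "equiv X R'" and T: "T ` S = X"
    and R: "R = {(a, b). a \<in> S \<and> b \<in> S \<and> (T a, T b) \<in> R'}"
  shows "bij_betw (\<lambda>C. \<Union>a\<in>C. R' `` {T a}) (S // R) (X // R')"
proof -
  have eqv: "equiv S R"
    using equiv_pullback[OF R' _ R] T by simp
  have resp: "(\<lambda>a. R' `` {T a}) respects R"
    by (rule respects_pullback[OF R' R])
  have val: "(\<Union>b\<in>R `` {a}. R' `` {T b}) = R' `` {T a}" if "a \<in> S" for a
    by (rule UN_equiv_class[OF eqv resp that])
  have "inj_on (\<lambda>C. \<Union>a\<in>C. R' `` {T a}) (S // R)"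
  proof (rule inj_onI)
    fix C D
    assume C: "C \<in> S // R" and D: "D \<in> S // R"
      and eq: "(\<Union>a\<in>C. R' `` {T a}) = (\<Union>a\<in>D. R' `` {T a})"
    show "C = D"
    proof (rule UN_equiv_class_inject[OF eqv resp eq C D])
      fix a b
      assume ab: "a \<in> S" "b \<in> S" "R' `` {T a} = R' `` {T b}"
      then have "(T a, T b) \<in> R'"
        using eq_equiv_class_iff[OF R'] T by blast
      then show "(a, b) \<in> R"
        using ab R by simp
    qed
  qed
  moreover have "(\<lambda>C. \<Union>a\<in>C. R' `` {T a}) ` (S // R) = X // R'"
  proof (intro equalityI subsetI)
    fix D
    assume "D \<in> (\<lambda>C. \<Union>a\<in>C. R' `` {T a}) ` (S // R)"
    then obtain a where "a \<in> S" "D = R' `` {T a}"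
      using val by (auto elim!: quotientE)
    then show "D \<in> X // R'"
      using T by (auto intro: quotientI)
  next
    fix D
    assume "D \<in> X // R'"
    then obtain a where a: "a \<in> S" "D = R' `` {T a}"
      using T by (auto elim!: quotientE)
    then show "D \<in> (\<lambda>C. \<Union>a\<in>C. R' `` {T a}) ` (S // R)"
      using val[OF a(1)] quotientI[OF a(1), of R] by (intro image_eqI[of _ _ "R `` {a}"]) auto
  qed
  ultimately show ?thesis
    by (simp add: bij_betw_def)
qed

section \<open>Linear and bilinear maps on subspaces\<close>

lemma linear_on_mem: "linear_on s t A B \<phi> \<Longrightarrow> x \<in> A \<Longrightarrow> \<phi> x \<in> B"
  and linear_on_add: "linear_on s t A B \<phi> \<Longrightarrow> x \<in> A \<Longrightarrow> y \<in> A \<Longrightarrow> \<phi> (x + y) = \<phi> x + \<phi> y"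
  and linear_on_scale: "linear_on s t A B \<phi> \<Longrightarrow> x \<in> A \<Longrightarrow> \<phi> (s c x) = t c (\<phi> x)"
  by (auto simp: linear_on_def)

lemma linear_on_zero:
  fixes \<phi> :: "'a::ab_group_add \<Rightarrow> 'b::ab_group_add"
  assumes "linear_on s t A B \<phi>" "0 \<in> A"
  shows "\<phi> 0 = 0"
  using linear_on_add[OF assms assms(2)] by simp

lemma linear_on_diff:
  fixes \<phi> :: "'a::ab_group_add \<Rightarrow> 'b::ab_group_add"
  assumes "linear_on s t A B \<phi>" "x \<in> A" "y \<in> A" "x - y \<in> A"
  shows "\<phi> (x - y) = \<phi> x - \<phi> y"
  using linear_on_add[OF assms(1,4,3)] by simp

lemmas linear_on_simps = linear_on_mem linear_on_add linear_on_scale linear_on_zero linear_on_diff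

lemma linear_on_compose_subset:
  assumes "linear_on s t A B \<phi>" "linear_on t u B C \<psi>" "A' \<subseteq> A"
  shows "linear_on s u A' C (\<lambda>x. \<psi> (\<phi> x))"
  using assms by (simp add: linear_on_def Pi_iff subset_iff)

text \<open>Linearity involves the values at sums and scalar multiples, so agreement on
  \<open>A\<close> suffices once \<open>A\<close> is closed under both. This replaces a map by its
  extensional restriction to \<open>A\<close>.\<close>

lemma (in module) linear_on_cong:
  assumes "linear_on scale t A B \<phi>" "subspace A" "\<And>x. x \<in> A \<Longrightarrow> \<psi> x = \<phi> x"
  shows "linear_on scale t A B \<psi>"
  using assms(1,3) subspace_add[OF assms(2)] subspace_scale[OF assms(2)]
  by (simp add: linear_on_def Pi_iff)

lemma bilinear_onD:
  assumes "bilinear_on s A B C \<beta>"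
  shows bilinear_on_right: "x \<in> A \<Longrightarrow> linear_on s s B C (\<beta> x)"
    and bilinear_on_left: "y \<in> B \<Longrightarrow> linear_on s s A C (\<lambda>x. \<beta> x y)"
  using assms by (auto simp: bilinear_on_def)

lemma bilinear_on_simps:
  fixes \<beta> :: "'a::ab_group_add \<Rightarrow> 'a \<Rightarrow> 'a"
  assumes \<beta>: "bilinear_on s A B C \<beta>"
  shows "x \<in> A \<Longrightarrow> y \<in> B \<Longrightarrow> \<beta> x y \<in> C"
    and "x \<in> A \<Longrightarrow> x' \<in> A \<Longrightarrow> y \<in> B \<Longrightarrow> \<beta> (x + x') y = \<beta> x y + \<beta> x' y"
    and "x \<in> A \<Longrightarrow> y \<in> B \<Longrightarrow> y' \<in> B \<Longrightarrow> \<beta> x (y + y') = \<beta> x y + \<beta> x y'"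
    and "x \<in> A \<Longrightarrow> y \<in> B \<Longrightarrow> \<beta> (s c x) y = s c (\<beta> x y)"
    and "x \<in> A \<Longrightarrow> y \<in> B \<Longrightarrow> \<beta> x (s c y) = s c (\<beta> x y)"
    and "0 \<in> A \<Longrightarrow> y \<in> B \<Longrightarrow> \<beta> 0 y = 0"
    and "x \<in> A \<Longrightarrow> 0 \<in> B \<Longrightarrow> \<beta> x 0 = 0"
  using linear_on_zero[OF bilinear_on_left[OF \<beta>]] linear_on_zero[OF bilinear_on_right[OF \<beta>]] \<beta>
  by (simp_all add: bilinear_on_def linear_on_def Pi_iff)

section \<open>Antisymmetry, and transport of the axioms along isomorphisms\<close>

text \<open>Polarization of the alternating law at \<open>x + y\<close>; this works in every
  characteristic.\<close>

lemma (in lie_algebra) bracket_swap: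
  assumes x: "x \<in> A" and y: "y \<in> A"
  shows "bracket y x = - bracket x y"
proof -
  have xy: "x + y \<in> A"
    using subspace_carrier x y by (rule subspace_add)
  have "bracket (x + y) (x + y) = bracket x y + bracket y x"
    using x y xy
    by (simp add: bilinear_on_simps[OF bilinear_bracket] bracket_self[OF x] bracket_self[OF y])
  then have "bracket x y + bracket y x = 0"
    using bracket_self[OF xy] by simp
  then show ?thesis
    by (simp add: eq_neg_iff_add_eq_0 add.commute)
qed

text \<open>On a proper carrier, \<open>inv_into A \<phi>\<close> undoes \<open>\<phi>\<close> only
  at points of \<open>A\<close>, so the operations have to stay in \<open>A\<close>. Closure is
  assumed instead of the algebra axioms so that the lemma applies to \<open>G \<times> V\<close> for
  data whose unified product is not yet known to be a Rota-Baxter Lie algebra.\<close>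

lemma rota_baxter_lie_iso_inv_into:
  assumes iso: "rota_baxter_lie_iso s A br P t B br' P' \<phi>"
    and A: "\<And>x y. x \<in> A \<Longrightarrow> y \<in> A \<Longrightarrow> x + y \<in> A" "\<And>c x. x \<in> A \<Longrightarrow> s c x \<in> A"
    and br: "\<And>x y. x \<in> A \<Longrightarrow> y \<in> A \<Longrightarrow> br x y \<in> A" and P: "\<And>x. x \<in> A \<Longrightarrow> P x \<in> A"
  shows "rota_baxter_lie_iso t B br' P' s A br P (inv_into A \<phi>)"
proof -
  have bij: "bij_betw \<phi> A B"
    using iso by (simp add: rota_baxter_lie_iso_def)
  have mem: "inv_into A \<phi> y \<in> A" "\<phi> (inv_into A \<phi> y) = y" if "y \<in> B" for y
    using that bij bij_betw_imp_surj_on[OF bij] by (auto simp: inv_into_into f_inv_into_f)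
  have eqI: "inv_into A \<phi> y = x" if "\<phi> x = y" "x \<in> A" for x y
    using that bij_betw_inv_into_left[OF bij] by blast
  have hom: "\<And>x y. x \<in> A \<Longrightarrow> y \<in> A \<Longrightarrow> \<phi> (x + y) = \<phi> x + \<phi> y"
    "\<And>c x. x \<in> A \<Longrightarrow> \<phi> (s c x) = t c (\<phi> x)"
    "\<And>x y. x \<in> A \<Longrightarrow> y \<in> A \<Longrightarrow> \<phi> (br x y) = br' (\<phi> x) (\<phi> y)"
    "\<And>x. x \<in> A \<Longrightarrow> \<phi> (P x) = P' (\<phi> x)"
    using iso by (auto simp: rota_baxter_lie_iso_def rota_baxter_lie_hom_def linear_on_def)
  show ?thesis
    unfolding rota_baxter_lie_iso_def rota_baxter_lie_hom_def linear_on_def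
    using bij_betw_inv_into[OF bij]
    by (intro conjI ballI allI Pi_I eqI) (simp_all add: hom mem A br P)
qed

text \<open>Each point of \<open>B\<close> is some \<open>\<phi> x\<close>, and the operations on
  such points are images of operations on \<open>A\<close>, so each axiom on \<open>B\<close> is the
  image of the same axiom on \<open>A\<close>.\<close>

lemma rota_baxter_lie_algebra_transport:
  assumes alg: "rota_baxter_lie_algebra s A br lam P" and t: "vector_space t"
    and iso: "rota_baxter_lie_iso s A br P t B br' P' \<phi>"
  shows "rota_baxter_lie_algebra t B br' lam P'"
proof -
  interpret rota_baxter_lie_algebra s A br lam P
    by (rule alg)
  interpret t: vector_space t
    by (rule t)
  have lin: "linear_on s t A B \<phi>" and B: "B = \<phi> ` A"
    using iso by (auto simp: rota_baxter_lie_iso_def rota_baxter_lie_hom_def bij_betw_def)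
  have br': "br' (\<phi> x) (\<phi> y) = \<phi> (br x y)" if "x \<in> A" "y \<in> A" for x y
    using iso that by (simp add: rota_baxter_lie_iso_def rota_baxter_lie_hom_def)
  have P': "P' (\<phi> x) = \<phi> (P x)" if "x \<in> A" for x
    using iso that by (simp add: rota_baxter_lie_iso_def rota_baxter_lie_hom_def)
  have A: "0 \<in> A" "\<And>x y. x \<in> A \<Longrightarrow> y \<in> A \<Longrightarrow> x + y \<in> A" "\<And>c x. x \<in> A \<Longrightarrow> s c x \<in> A"
    using subspace_carrier by (auto simp: subspace_def)
  \<comment> \<open>Oriented to pull \<open>\<phi>\<close> outwards: a term over \<open>B\<close>
    collapses to \<open>\<phi>\<close> of a single term over \<open>A\<close>, where the axiom can
    be applied.\<close>
  have \<phi>: "\<phi> 0 = 0" "\<And>x y. x \<in> A \<Longrightarrow> y \<in> A \<Longrightarrow> \<phi> x + \<phi> y = \<phi> (x + y)"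
    "\<And>c x. x \<in> A \<Longrightarrow> t c (\<phi> x) = \<phi> (s c x)"
    by (simp_all add: linear_on_zero[OF lin] linear_on_add[OF lin] linear_on_scale[OF lin] A(1))
  note br = bilinear_on_simps[OF bilinear_bracket]
  note P = linear_on_simps[OF linear_operator]
  show ?thesis
  proof unfold_locales
    show "t.subspace B"
      unfolding t.subspace_def B using imageI[OF A(1), of \<phi>] by (auto simp: \<phi> A)
    show "bilinear_on t B B B br'"
      unfolding bilinear_on_def linear_on_def B by (auto simp: \<phi> br' br A)
    show "br' x x = 0" if "x \<in> B" for x
      using that unfolding B by (auto simp: br' bracket_self \<phi>)
    show "br' x (br' y z) + br' y (br' z x) + br' z (br' x y) = 0"
      if "x \<in> B" "y \<in> B" "z \<in> B" for x y z
      using that unfolding B by (auto simp: br' br(1) \<phi> A jacobi)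
    show "linear_on t t B B P'"
      unfolding linear_on_def B by (auto simp: \<phi> P' P A)
    show "br' (P' x) (P' y) = P' (br' (P' x) y + br' x (P' y) + t lam (br' x y))"
      if "x \<in> B" "y \<in> B" for x y
      using that unfolding B by (auto simp: br' br(1) P' P(1) \<phi> A rota_baxter)
  qed
qed

section \<open>The decomposition of E into \<open>G\<close> and \<open>V\<close> and its
  projections\<close>

locale rota_baxter_lie_extension = rota_baxter_lie_algebra smul G brG lam PG
  for smul :: "'k::field \<Rightarrow> 'e::ab_group_add \<Rightarrow> 'e" and G brG lam PG +
  fixes V :: "'e set"
  assumes complement: "complement smul G V"
begin

lemma G_mem [simp]:
  "0 \<in> G" "x \<in> G \<Longrightarrow> y \<in> G \<Longrightarrow> x + y \<in> G" "x \<in> G \<Longrightarrow> y \<in> G \<Longrightarrow> x - y \<in> G"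
  "x \<in> G \<Longrightarrow> smul c x \<in> G"
  using subspace_carrier by (auto simp: subspace_0 subspace_add subspace_diff subspace_scale)

lemma subspace_V: "subspace V"
  using complement by (simp add: complement_def)

lemma V_mem [simp]:
  "0 \<in> V" "x \<in> V \<Longrightarrow> y \<in> V \<Longrightarrow> x + y \<in> V" "x \<in> V \<Longrightarrow> y \<in> V \<Longrightarrow> x - y \<in> V"
  "x \<in> V \<Longrightarrow> smul c x \<in> V"
  using subspace_V by (auto simp: subspace_0 subspace_add subspace_diff subspace_scale)

lemma decomposition_unique:
  assumes "g \<in> G" "h \<in> G" "x \<in> V" "y \<in> V" "g + x = h + y"
  shows "g = h" "x = y"
proof -
  have "g - h = y - x"
    using assms(5) by (simp add: algebra_simps)
  then have "g - h \<in> G \<inter> V"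
    using assms by (metis G_mem(3) IntI V_mem(3))
  then have "g - h = 0"
    using complement unfolding complement_def by blast
  then show "g = h" "x = y"
    using assms(5) by auto
qed

lemma decomposition_eq_iff:
  assumes "g \<in> G" "h \<in> G" "x \<in> V" "y \<in> V"
  shows "g + x = h + y \<longleftrightarrow> g = h \<and> x = y"
  using decomposition_unique assms by blast

lemma sum_map_Pair [simp]: "sum_map (a, b) = (a + b :: 'e)"
  by (simp add: sum_map_def)

lemma bij_betw_sum_map: "bij_betw sum_map (G \<times> V) UNIV"
  unfolding bij_betw_def
proof
  show "inj_on sum_map (G \<times> V)"
    by (auto simp: inj_on_def decomposition_eq_iff)
  have "e \<in> sum_map ` (G \<times> V)" for e
    using complement unfolding complement_def sum_map_def by force
  then show "sum_map ` (G \<times> V) = UNIV"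
    by blast
qed

text \<open>\<open>gpart\<close> and \<open>vpart\<close> are the projections onto \<open>G\<close>
  along \<open>V\<close> and onto \<open>V\<close> along \<open>G\<close>. They are taken from the
  inverse of \<open>sum_map\<close> because \<open>transported_structure\<close> is defined through
  that inverse.\<close>

definition gpart :: "'e \<Rightarrow> 'e" where "gpart e = fst (inv_into (G \<times> V) sum_map e)"
definition vpart :: "'e \<Rightarrow> 'e" where "vpart e = snd (inv_into (G \<times> V) sum_map e)"

lemma inv_sum_map: "inv_into (G \<times> V) sum_map e = (gpart e, vpart e)"
  by (simp add: gpart_def vpart_def)

lemma parts_mem [simp]: "gpart e \<in> G" "vpart e \<in> V"
  and parts_add [simp]: "gpart e + vpart e = e"
proof -
  have e: "e \<in> sum_map ` (G \<times> V)"
    using bij_betw_sum_map by (simp add: bij_betw_def)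
  show "gpart e \<in> G" "vpart e \<in> V"
    using inv_into_into[OF e] by (auto simp: inv_sum_map)
  show "gpart e + vpart e = e"
    using f_inv_into_f[OF e] by (simp add: inv_sum_map)
qed

lemma parts_sum [simp]:
  assumes "g \<in> G" "x \<in> V"
  shows "gpart (g + x) = g" "vpart (g + x) = x"
  by (rule decomposition_unique[of "gpart (g + x)" g "vpart (g + x)" x]; simp add: assms)+

lemma parts_G [simp]: "g \<in> G \<Longrightarrow> gpart g = g" "g \<in> G \<Longrightarrow> vpart g = 0"
  using parts_sum[of g 0] by auto

lemma parts_V [simp]: "x \<in> V \<Longrightarrow> gpart x = 0" "x \<in> V \<Longrightarrow> vpart x = x"
  using parts_sum[of 0 x] by auto

lemma linear_on_gpart: "linear_on smul smul UNIV G gpart"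
  and linear_on_vpart: "linear_on smul smul UNIV V vpart"
proof -
  have "a + b = (gpart a + gpart b) + (vpart a + vpart b)" for a b
    by (metis add.assoc add.left_commute parts_add)
  then have add: "gpart (a + b) = gpart a + gpart b" "vpart (a + b) = vpart a + vpart b" for a b
    by (metis parts_sum parts_mem G_mem(2) V_mem(2))+
  have "smul c a = smul c (gpart a) + smul c (vpart a)" for c a
    by (metis parts_add scale_right_distrib)
  then have scale: "gpart (smul c a) = smul c (gpart a)" "vpart (smul c a) = smul c (vpart a)" for c a
    by (metis parts_sum parts_mem G_mem(4) V_mem(4))+
  show "linear_on smul smul UNIV G gpart" "linear_on smul smul UNIV V vpart"
    by (auto simp: linear_on_def add scale)
qed

lemma decomposition_cases:
  obtains g x where "g \<in> G" "x \<in> V" "e = g + x"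
  by (metis parts_add parts_mem)

lemmas brG_simps [simp] = bilinear_on_simps[OF bilinear_bracket]
lemmas PG_simps [simp] = linear_on_simps[OF linear_operator]

section \<open>Extending data and the structures they induce on E\<close>

lemma extending_dataD:
  assumes "d \<in> extending_data smul G V"
  shows "bilinear_on smul V G V (ract d)" "bilinear_on smul V G G (lact d)"
    "bilinear_on smul V V G (cocyc d)" "bilinear_on smul V V V (curly d)"
    "linear_on smul smul V G (op1 d)" "linear_on smul smul V V (op2 d)"
  using assms by (auto simp: extending_data_def)

lemmas datum_simps [simp] =
  extending_dataD(1)[THEN bilinear_on_simps(1)] extending_dataD(1)[THEN bilinear_on_simps(2)]
  extending_dataD(1)[THEN bilinear_on_simps(3)] extending_dataD(1)[THEN bilinear_on_simps(6)]
  extending_dataD(1)[THEN bilinear_on_simps(7)]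
  extending_dataD(2)[THEN bilinear_on_simps(1)] extending_dataD(2)[THEN bilinear_on_simps(2)]
  extending_dataD(2)[THEN bilinear_on_simps(3)] extending_dataD(2)[THEN bilinear_on_simps(6)]
  extending_dataD(2)[THEN bilinear_on_simps(7)]
  extending_dataD(3)[THEN bilinear_on_simps(1)] extending_dataD(3)[THEN bilinear_on_simps(2)]
  extending_dataD(3)[THEN bilinear_on_simps(3)] extending_dataD(3)[THEN bilinear_on_simps(6)]
  extending_dataD(3)[THEN bilinear_on_simps(7)]
  extending_dataD(4)[THEN bilinear_on_simps(1)] extending_dataD(4)[THEN bilinear_on_simps(2)]
  extending_dataD(4)[THEN bilinear_on_simps(3)] extending_dataD(4)[THEN bilinear_on_simps(6)]
  extending_dataD(4)[THEN bilinear_on_simps(7)]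
  extending_dataD(5)[THEN linear_on_mem] extending_dataD(5)[THEN linear_on_zero]
  extending_dataD(6)[THEN linear_on_mem] extending_dataD(6)[THEN linear_on_zero]

abbreviation transported_bracket :: "'e extending_datum \<Rightarrow> 'e \<Rightarrow> 'e \<Rightarrow> 'e"
  where "transported_bracket d \<equiv> fst (transported_structure G brG PG V d)"

abbreviation transported_operator :: "'e extending_datum \<Rightarrow> 'e \<Rightarrow> 'e"
  where "transported_operator d \<equiv> snd (transported_structure G brG PG V d)"

text \<open>The right side keeps the component in \<open>G\<close> and the component in
  \<open>V\<close> as two separate summands, so that \<open>decomposition_unique\<close> can compare
  them one by one.\<close>

lemma transported_bracket_sum:
  assumes "g \<in> G" "x \<in> V" "h \<in> G" "y \<in> V"
  shows "transported_bracket d (g + x) (h + y) =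
    (brG g h + lact d x h - lact d y g + cocyc d x y) + (curly d x y + ract d x h - ract d y g)"
  using assms
  by (simp add: transported_structure_def Let_def inv_sum_map unified_bracket_def)

lemma transported_operator_sum:
  assumes "g \<in> G" "x \<in> V"
  shows "transported_operator d (g + x) = (PG g + op1 d x) + op2 d x"
  using assms
  by (simp add: transported_structure_def Let_def inv_sum_map unified_operator_def)

text \<open>Setting components to 0 isolates the maps of the datum: \<open>lact\<close> and
  \<open>ract\<close> are the two components of the bracket of \<open>V\<close> with
  \<open>G\<close>, \<open>cocyc\<close> and \<open>curly\<close> those of the bracket on
  \<open>V\<close>.\<close>

lemma transported_bracket_on:
  assumes d: "d \<in> extending_data smul G V"
  shows "g \<in> G \<Longrightarrow> h \<in> G \<Longrightarrow> transported_bracket d g h = brG g h"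
    and "x \<in> V \<Longrightarrow> h \<in> G \<Longrightarrow> transported_bracket d x h = lact d x h + ract d x h"
    and "x \<in> V \<Longrightarrow> y \<in> V \<Longrightarrow> transported_bracket d x y = cocyc d x y + curly d x y"
  using transported_bracket_sum[of g 0 h 0 d] transported_bracket_sum[of 0 x h 0 d]
    transported_bracket_sum[of 0 x 0 y d] d
  by auto

lemma transported_operator_on:
  assumes d: "d \<in> extending_data smul G V"
  shows "g \<in> G \<Longrightarrow> transported_operator d g = PG g"
    and "x \<in> V \<Longrightarrow> transported_operator d x = op1 d x + op2 d x"
  using transported_operator_sum[of g 0 d] transported_operator_sum[of 0 x d] d by auto

lemma vector_space_prod_scale: "vector_space (module_prod.scale smul smul)"
proof -
  interpret vector_space_prod smul smul ..
  show ?thesis ..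
qed

lemma scale_Pair: "module_prod.scale smul smul c (g, x) = (smul c g, smul c x)"
proof -
  interpret vector_space_prod smul smul ..
  show ?thesis by (rule scale_prod)
qed

text \<open>Holds by construction of the transported structure. It concerns the operations alone, so
  it is available before either side is known to satisfy the axioms.\<close>

lemma rota_baxter_lie_iso_sum_map:
  assumes d: "d \<in> extending_data smul G V"
  shows "rota_baxter_lie_iso (module_prod.scale smul smul) (G \<times> V)
    (unified_bracket brG d) (unified_operator PG d)
    smul UNIV (transported_bracket d) (transported_operator d) sum_map"
  using d bij_betw_sum_map
  by (auto simp: rota_baxter_lie_iso_def rota_baxter_lie_hom_def linear_on_def scale_Pair
      scale_right_distrib unified_bracket_def unified_operator_def
      transported_bracket_sum transported_operator_sum)

text \<open>The axioms pass along \<open>sum_map\<close> in one direction and along its inverse in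
  the other. For every datum the transported structure restricts to the given one on
  \<open>G\<close>, so the subalgebra condition adds no further constraint.\<close>

lemma extending_structures_iff:
  assumes d: "d \<in> extending_data smul G V"
  shows "d \<in> extending_structures smul lam G brG PG V \<longleftrightarrow>
    transported_structure G brG PG V d \<in> extd_structures smul lam G brG PG"
proof -
  let ?s = "module_prod.scale smul smul"
  note iso = rota_baxter_lie_iso_sum_map[OF d]
  have iso': "rota_baxter_lie_iso smul UNIV (transported_bracket d) (transported_operator d)
    ?s (G \<times> V) (unified_bracket brG d) (unified_operator PG d) (inv_into (G \<times> V) sum_map)"
    by (rule rota_baxter_lie_iso_inv_into[OF iso])
      (auto simp: scale_Pair unified_bracket_def unified_operator_def d)
  have "rota_baxter_lie_algebra ?s (G \<times> V) (unified_bracket brG d) lam (unified_operator PG d) \<longleftrightarrow>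
    rota_baxter_lie_algebra smul UNIV (transported_bracket d) lam (transported_operator d)"
    using rota_baxter_lie_algebra_transport[OF _ vector_space_axioms iso]
      rota_baxter_lie_algebra_transport[OF _ vector_space_prod_scale iso'] by blast
  then show ?thesis
    using d rota_baxter_lie_algebra_axioms
    by (auto simp: extending_structures_def extd_structures_def rota_baxter_lie_subalgebra_def
        case_prod_unfold transported_bracket_on transported_operator_on)
qed

section \<open>Recovering a datum from a structure on E\<close>

text \<open>A right inverse of the transport. The brackets on \<open>G\<close> are already given by
  \<open>brG\<close>, and those of \<open>G\<close> with \<open>V\<close> follow by antisymmetry, so
  only the pairs in \<open>V \<times> G\<close> and \<open>V \<times> V\<close> are recorded. The
  restrictions make the components extensional, as \<open>extending_data\<close> demands.\<close>

definition structure_datum :: "('e \<Rightarrow> 'e \<Rightarrow> 'e) \<times> ('e \<Rightarrow> 'e) \<Rightarrow> 'e extending_datum" where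
  "structure_datum = (\<lambda>(br, P).
     \<lparr>ract = \<lambda>x\<in>V. \<lambda>g\<in>G. vpart (br x g), lact = \<lambda>x\<in>V. \<lambda>g\<in>G. gpart (br x g),
      cocyc = \<lambda>x\<in>V. \<lambda>y\<in>V. gpart (br x y), curly = \<lambda>x\<in>V. \<lambda>y\<in>V. vpart (br x y),
      op1 = \<lambda>x\<in>V. gpart (P x), op2 = \<lambda>x\<in>V. vpart (P x)\<rparr>)"

lemma structure_datum_mem:
  assumes B: "B \<in> extd_structures smul lam G brG PG"
  shows "structure_datum B \<in> extending_data smul G V"
proof -
  obtain br P where B_eq: "B = (br, P)"
    by (cases B)
  interpret E: rota_baxter_lie_algebra smul UNIV br lam P
    using B by (simp add: B_eq extd_structures_def rota_baxter_lie_subalgebra_def)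
  \<comment> \<open>All four bilinear components of the datum have this shape, with \<open>p\<close>
    one of the two projections.\<close>
  have bilinear: "bilinear_on smul A B C (\<lambda>x\<in>A. \<lambda>y\<in>B. p (br x y))"
    if A: "subspace A" and B: "subspace B" and p: "linear_on smul smul UNIV C p" for A B C p
    unfolding bilinear_on_def
  proof (intro conjI ballI)
    fix x
    assume x: "x \<in> A"
    have "linear_on smul smul B C (\<lambda>y. p (br x y))"
      using linear_on_compose_subset[OF bilinear_on_right[OF E.bilinear_bracket] p, of x] by simp
    then show "linear_on smul smul B C ((\<lambda>x\<in>A. \<lambda>y\<in>B. p (br x y)) x)"
      using B by (rule linear_on_cong) (simp add: x)
  next
    fix y
    assume y: "y \<in> B"
    have "linear_on smul smul A C (\<lambda>x. p (br x y))"
      using linear_on_compose_subset[OF bilinear_on_left[OF E.bilinear_bracket] p, of y] by simp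
    then show "linear_on smul smul A C (\<lambda>x. (\<lambda>x\<in>A. \<lambda>y\<in>B. p (br x y)) x y)"
      using A by (rule linear_on_cong) (simp add: y)
  qed
  have linear: "linear_on smul smul V C (\<lambda>x\<in>V. p (P x))"
    if "linear_on smul smul UNIV C p" for C p
    using linear_on_compose_subset[OF E.linear_operator that] subspace_V
    by (rule linear_on_cong) simp_all
  show ?thesis
    using bilinear[OF subspace_V subspace_carrier] bilinear[OF subspace_V subspace_V] linear
      linear_on_gpart linear_on_vpart
    by (simp add: B_eq structure_datum_def extending_data_def restrict_PiE_iff)
qed

text \<open>Expanding the bracket of \<open>g + x\<close> and \<open>h + y\<close> gives four
  brackets. The one on \<open>G\<close> agrees with \<open>brG\<close>, those of \<open>x\<close>
  with \<open>h\<close> and of \<open>x\<close> with \<open>y\<close> are the sums of their recorded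
  components, and the one of \<open>g\<close> with \<open>y\<close> is minus the recorded one of
  \<open>y\<close> with \<open>g\<close>.\<close>

lemma transported_structure_datum:
  assumes B: "B \<in> extd_structures smul lam G brG PG"
  shows "transported_structure G brG PG V (structure_datum B) = B"
proof -
  obtain br P where B_eq: "B = (br, P)"
    by (cases B)
  have sub: "br g h = brG g h" "P g = PG g" if "g \<in> G" "h \<in> G" for g h
    using B that by (auto simp: B_eq extd_structures_def rota_baxter_lie_subalgebra_def)
  interpret E: rota_baxter_lie_algebra smul UNIV br lam P
    using B by (simp add: B_eq extd_structures_def rota_baxter_lie_subalgebra_def)
  note [simp] = bilinear_on_simps[OF E.bilinear_bracket] linear_on_simps[OF E.linear_operator]
  let ?d = "structure_datum B"
  have "transported_bracket ?d a b = br a b" for a b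
  proof -
    obtain g x where a: "g \<in> G" "x \<in> V" "a = g + x" by (rule decomposition_cases)
    obtain h y where b: "h \<in> G" "y \<in> V" "b = h + y" by (rule decomposition_cases)
    \<comment> \<open>The components are regrouped by the bracket they come from.
      \<open>parts_add\<close> is held back so that these pairs stay visible; afterwards it merges
      each pair.\<close>
    have "transported_bracket ?d a b =
      br g h + (gpart (br x h) + vpart (br x h)) - (gpart (br y g) + vpart (br y g))
      + (gpart (br x y) + vpart (br x y))"
      using a b
      by (simp add: transported_bracket_sum sub del: parts_add)
        (simp add: structure_datum_def B_eq algebra_simps del: parts_add)
    also have "\<dots> = br a b"
      using a b E.bracket_swap[of g y] by simp
    finally show ?thesis .
  qed
  moreover have "transported_operator ?d a = P a" for a
  proof -
    obtain g x where a: "g \<in> G" "x \<in> V" "a = g + x" by (rule decomposition_cases)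
    then show ?thesis
      by (simp add: transported_operator_sum sub structure_datum_def B_eq add.assoc)
  qed
  ultimately show ?thesis
    by (simp add: B_eq prod_eq_iff fun_eq_iff)
qed

text \<open>This is the surjection along which the equivalence of structures is pulled back;
  \<open>structure_datum B\<close> is a preimage of \<open>B\<close>.\<close>

lemma transported_structures:
  "transported_structure G brG PG V ` extending_structures smul lam G brG PG V =
   extd_structures smul lam G brG PG"
proof (intro equalityI subsetI)
  fix B
  assume "B \<in> transported_structure G brG PG V ` extending_structures smul lam G brG PG V"
  then show "B \<in> extd_structures smul lam G brG PG"
    using extending_structures_iff by (auto simp: extending_structures_def)
next
  fix B
  assume B: "B \<in> extd_structures smul lam G brG PG"
  then show "B \<in> transported_structure G brG PG V ` extending_structures smul lam G brG PG V"
    using extending_structures_iff[OF structure_datum_mem[OF B]] transported_structure_datum[OF B]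
    by (metis imageI)
qed

section \<open>Equivalences of data and isomorphisms fixing \<open>G\<close>\<close>

text \<open>
  The formulas of \<^const>\<open>datum_equivalent\<close> after substituting \<open>v x\<close>, \<open>v y\<close> for \<open>x\<close>, \<open>y\<close>,
  which removes the inverse of \<open>v\<close>.
\<close>

definition datum_morphism ::
  "'e extending_datum \<Rightarrow> 'e extending_datum \<Rightarrow> ('e \<Rightarrow> 'e) \<Rightarrow> ('e \<Rightarrow> 'e) \<Rightarrow> bool"
where
  "datum_morphism d d' r v \<longleftrightarrow>
     (\<forall>x\<in>V. \<forall>g\<in>G. ract d' (v x) g = v (ract d x g) \<and>
        lact d' (v x) g = r (ract d x g) + lact d x g + brG g (r x)) \<and>
     (\<forall>x\<in>V. \<forall>y\<in>V. cocyc d' (v x) (v y) =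
          cocyc d x y + r (curly d x y) + brG (r x) (r y)
          - r (ract d x (r y)) - lact d x (r y) + r (ract d y (r x)) + lact d y (r x) \<and>
        curly d' (v x) (v y) = v (curly d x y) - v (ract d x (r y)) + v (ract d y (r x))) \<and>
     (\<forall>x\<in>V. op1 d' (v x) = op1 d x - PG (r x) + r (op2 d x) \<and> op2 d' (v x) = v (op2 d x))"

lemma datum_equivalent_iff:
  "datum_equivalent smul G brG PG V d d' \<longleftrightarrow>
   (\<exists>r v. linear_on smul smul V G r \<and> linear_on smul smul V V v \<and> bij_betw v V V \<and>
     datum_morphism d d' r v)"
proof -
  \<comment> \<open>Reindexing along the bijection \<open>v\<close>: as \<open>x\<close> and
    \<open>y\<close> run through \<open>V\<close>, so do \<open>v x\<close> and \<open>v y\<close>.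
    The predicate sees both a point and its preimage, hence the five arguments.\<close>
  have ball: "(\<forall>g\<in>G. \<forall>x\<in>V. \<forall>y\<in>V. Q g (inv_into V v x) (inv_into V v y) x y) \<longleftrightarrow>
      (\<forall>g\<in>G. \<forall>x\<in>V. \<forall>y\<in>V. Q g x y (v x) (v y))" (is "?L \<longleftrightarrow> ?R")
    if v: "bij_betw v V V" for v :: "'e \<Rightarrow> 'e" and Q :: "'e \<Rightarrow> 'e \<Rightarrow> 'e \<Rightarrow> 'e \<Rightarrow> 'e \<Rightarrow> bool"
  proof
    assume L: ?L
    show ?R
    proof (intro ballI)
      fix g x y
      assume "g \<in> G" "x \<in> V" "y \<in> V"
      then show "Q g x y (v x) (v y)"
        using L[rule_format, of g "v x" "v y"] bij_betw_inv_into_left[OF v] bij_betw_apply[OF v]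
        by simp
    qed
  next
    assume R: ?R
    show ?L
    proof (intro ballI)
      fix g x y
      assume "g \<in> G" "x \<in> V" "y \<in> V"
      then show "Q g (inv_into V v x) (inv_into V v y) x y"
        using R[rule_format, of g "inv_into V v x" "inv_into V v y"]
          bij_betw_inv_into_right[OF v] bij_betw_apply[OF bij_betw_inv_into[OF v]]
        by simp
    qed
  qed
  \<comment> \<open>In \<open>datum_equivalent\<close> one prefix over \<open>g\<close>,
    \<open>x\<close>, \<open>y\<close> governs all formulas, while \<open>datum_morphism\<close>
    quantifies each over its own variables only. Dropping the idle quantifiers requires inhabited
    \<open>G\<close> and \<open>V\<close>.\<close>
  have ne: "\<exists>g. g \<in> G" "\<exists>x. x \<in> V"
    using G_mem(1) V_mem(1) by blast+
  show ?thesis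
    unfolding datum_equivalent_def Let_def
    apply (intro ex_cong1 conj_cong refl)
    apply (subst ball, assumption)
    unfolding datum_morphism_def using ne by blast
qed

text \<open>The map is the shear sending \<open>g + x\<close> to \<open>(g + r x) + v x\<close>.
  Once both arguments are split along \<open>G\<close> and \<open>V\<close>, bilinearity and
  antisymmetry reduce the morphism equations to the formulas of
  \<open>datum_morphism\<close>.\<close>

lemma hom_of_datum_morphism:
  assumes d: "d \<in> extending_data smul G V" and d': "d' \<in> extending_data smul G V"
    and r: "linear_on smul smul V G r" and v: "linear_on smul smul V V v"
    and rv: "datum_morphism d d' r v"
  shows "rota_baxter_lie_hom smul UNIV (transported_bracket d) (transported_operator d)
    smul UNIV (transported_bracket d') (transported_operator d')
    (\<lambda>e. (gpart e + r (vpart e)) + v (vpart e))"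
    (is "rota_baxter_lie_hom _ _ _ _ _ _ _ _ ?\<phi>")
proof -
  note [simp] = linear_on_simps[OF r] linear_on_simps[OF v] d d'
  note parts_linear = linear_on_simps[OF linear_on_gpart] linear_on_simps[OF linear_on_vpart]
  have rv1: "ract d' (v x) g = v (ract d x g)"
    "lact d' (v x) g = r (ract d x g) + lact d x g + brG g (r x)" if "x \<in> V" "g \<in> G" for x g
    using rv that by (auto simp: datum_morphism_def)
  have rv2: "cocyc d' (v x) (v y) =
      cocyc d x y + r (curly d x y) + brG (r x) (r y)
      - r (ract d x (r y)) - lact d x (r y) + r (ract d y (r x)) + lact d y (r x)"
    "curly d' (v x) (v y) = v (curly d x y) - v (ract d x (r y)) + v (ract d y (r x))"
    if "x \<in> V" "y \<in> V" for x y
    using rv that by (auto simp: datum_morphism_def)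
  have rv3: "op1 d' (v x) = op1 d x - PG (r x) + r (op2 d x)" "op2 d' (v x) = v (op2 d x)"
    if "x \<in> V" for x
    using rv that by (auto simp: datum_morphism_def)
  have \<phi>: "?\<phi> (g + x) = (g + r x) + v x" if "g \<in> G" "x \<in> V" for g x
    using that by simp
  have "?\<phi> (transported_bracket d a b) = transported_bracket d' (?\<phi> a) (?\<phi> b)" for a b
  proof -
    obtain g x where a: "g \<in> G" "x \<in> V" "a = g + x" by (rule decomposition_cases)
    obtain h y where b: "h \<in> G" "y \<in> V" "b = h + y" by (rule decomposition_cases)
    show ?thesis
      \<comment> \<open>On the right side, the brackets of \<open>r x\<close> with \<open>h\<close>
        and of \<open>g\<close> with \<open>r y\<close> cancel against those contributed by
        \<open>lact d'\<close>. The four brackets of \<open>r x\<close> and \<open>r y\<close> also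
        cancel: one from \<open>brG\<close>, two from \<open>lact d'\<close>, one from
        \<open>cocyc d'\<close>.\<close>
      unfolding a(3) b(3) \<phi>[OF a(1,2)] \<phi>[OF b(1,2)]
      using a b bracket_swap[of h "r x"] bracket_swap[of "r x" "r y"]
      by (simp add: transported_bracket_sum \<phi> rv1 rv2 del: parts_sum)
  qed
  moreover have "?\<phi> (transported_operator d a) = transported_operator d' (?\<phi> a)" for a
  proof -
    obtain g x where a: "g \<in> G" "x \<in> V" "a = g + x" by (rule decomposition_cases)
    show ?thesis
      unfolding a(3) \<phi>[OF a(1,2)]
      using a by (simp add: transported_operator_sum \<phi> rv3 del: parts_sum)
  qed
  moreover have "linear_on smul smul UNIV UNIV ?\<phi>"
    by (auto simp: linear_on_def parts_linear scale_right_distrib algebra_simps)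
  ultimately show ?thesis
    unfolding rota_baxter_lie_hom_def by blast
qed

lemma bij_of_shear:
  assumes r: "linear_on smul smul V G r" and v: "bij_betw v V V"
  shows "bij (\<lambda>e. (gpart e + r (vpart e)) + v (vpart e))"
proof -
  have v_mem [simp]: "v x \<in> V" if "x \<in> V" for x
    using v that by (rule bij_betw_apply)
  note [simp] = linear_on_simps[OF r]
  let ?\<phi> = "\<lambda>e. (gpart e + r (vpart e)) + v (vpart e)"
  \<comment> \<open>Obtained by solving \<open>g + r x = h\<close> and \<open>v x = y\<close>: first
    \<open>x\<close> is the preimage of \<open>y\<close> under \<open>v\<close>, then
    \<open>g = h - r x\<close>.\<close>
  let ?\<psi> = "\<lambda>e. (gpart e - r (inv_into V v (vpart e))) + inv_into V v (vpart e)"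
  have inv_mem [simp]: "inv_into V v x \<in> V" if "x \<in> V" for x
    using bij_betw_inv_into[OF v] that by (rule bij_betw_apply)
  have "?\<psi> (?\<phi> e) = e" for e
    by (simp add: bij_betw_inv_into_left[OF v])
  moreover have "?\<phi> (?\<psi> e) = e" for e
    by (simp add: bij_betw_inv_into_right[OF v])
  ultimately show ?thesis
    by (intro bij_betw_byWitness[where f' = ?\<psi>]) auto
qed

text \<open>Since \<open>\<phi>\<close> fixes \<open>G\<close>, it is determined by its values on
  \<open>V\<close>, and \<open>r\<close> and \<open>v\<close> are the two components of these
  values. The formulas come from comparing components in the morphism equations.\<close>

lemma datum_morphism_of_iso:
  assumes d: "d \<in> extending_data smul G V" and d': "d' \<in> extending_data smul G V"
    and iso: "rota_baxter_lie_iso smul UNIV (transported_bracket d) (transported_operator d)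
      smul UNIV (transported_bracket d') (transported_operator d') \<phi>"
    and stab: "\<And>g. g \<in> G \<Longrightarrow> \<phi> g = g"
  shows "linear_on smul smul V G (gpart \<circ> \<phi>)" "linear_on smul smul V V (vpart \<circ> \<phi>)"
    "bij_betw (vpart \<circ> \<phi>) V V" "datum_morphism d d' (gpart \<circ> \<phi>) (vpart \<circ> \<phi>)"
proof -
  have lin: "linear_on smul smul UNIV UNIV \<phi>" and bij: "bij \<phi>"
    and br: "\<And>a b. \<phi> (transported_bracket d a b) = transported_bracket d' (\<phi> a) (\<phi> b)"
    and P: "\<And>a. \<phi> (transported_operator d a) = transported_operator d' (\<phi> a)"
    using iso by (auto simp: rota_baxter_lie_iso_def rota_baxter_lie_hom_def)
  define r where "r = gpart \<circ> \<phi>"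
  define v where "v = vpart \<circ> \<phi>"
  note parts_linear = linear_on_simps[OF linear_on_gpart] linear_on_simps[OF linear_on_vpart]
  show r: "linear_on smul smul V G (gpart \<circ> \<phi>)" and v: "linear_on smul smul V V (vpart \<circ> \<phi>)"
    by (auto simp: linear_on_def parts_linear linear_on_simps[OF lin])
  note [simp] = linear_on_simps[OF r, folded r_def] linear_on_simps[OF v, folded v_def] d d'
  have \<phi>_V: "\<phi> x = r x + v x" for x
    by (simp add: r_def v_def)
  have \<phi>: "\<phi> (g + x) = (g + r x) + v x" if "g \<in> G" "x \<in> V" for g x
    using linear_on_add[OF lin, of g x] that by (simp add: stab \<phi>_V[of x] add.assoc)
  show "bij_betw (vpart \<circ> \<phi>) V V"
    unfolding v_def[symmetric] bij_betw_def
  proof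
    show "inj_on v V"
    proof (rule inj_onI)
      fix x y
      assume xy: "x \<in> V" "y \<in> V" "v x = v y"
      \<comment> \<open>If \<open>v x = v y\<close>, the images of \<open>x\<close> and
        \<open>y\<close> differ only by elements of \<open>G\<close>, which \<open>\<phi>\<close>
        fixes. Adding \<open>r y\<close> to one argument and \<open>r x\<close> to the other makes
        the images equal.\<close>
      then have "\<phi> (r y + x) = \<phi> (r x + y)"
        using \<phi>[of "r y" x] \<phi>[of "r x" y] by (simp add: add_ac)
      then have "r y + x = r x + y"
        using bij by (simp add: bij_def inj_eq)
      then show "x = y"
        using xy by (simp add: decomposition_eq_iff)
    qed
    have "y \<in> v ` V" if y: "y \<in> V" for y
    proof -
      \<comment> \<open>The target is written \<open>0 + y\<close> so that its components can be
        compared with those of \<open>\<phi> (g + x)\<close>.\<close>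
      obtain e where e: "\<phi> e = 0 + y"
        using bij by (metis add_0 bij_pointE)
      obtain g x where gx: "g \<in> G" "x \<in> V" "e = g + x" by (rule decomposition_cases)
      then have "(g + r x) + v x = 0 + y"
        using e \<phi> by simp
      from decomposition_unique(2)[OF _ _ _ _ this] have "v x = y"
        using gx y by simp
      then show ?thesis
        using gx by blast
    qed
    then show "v ` V = V"
      using linear_on_mem[OF v] by (auto simp: v_def)
  qed
  have "ract d' (v x) g = v (ract d x g) \<and>
      lact d' (v x) g = r (ract d x g) + lact d x g + brG g (r x)"
    if "x \<in> V" "g \<in> G" for x g
  proof -
    \<comment> \<open>Both arguments on the right are put in the form of an element of
      \<open>G\<close> plus an element of \<open>V\<close>, with 0 as the second part of
      \<open>g\<close>, so that \<open>transported_bracket_sum\<close> applies.\<close>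
    have "\<phi> (transported_bracket d x g) = transported_bracket d' (r x + v x) (g + 0)"
      using that by (simp only: br \<phi>_V[of x] stab add_0_right)
    then have "(lact d x g + r (ract d x g)) + v (ract d x g) =
      (brG (r x) g + lact d' (v x) g) + ract d' (v x) g"
      using that transported_bracket_sum[of "r x" "v x" g 0 d']
      by (simp add: \<phi> transported_bracket_on)
    from decomposition_unique[OF _ _ _ _ this] show ?thesis
      using that bracket_swap[of g "r x"] by (simp add: algebra_simps)
  qed
  note rv1 = this[THEN conjunct1] this[THEN conjunct2]
  have "cocyc d' (v x) (v y) =
      cocyc d x y + r (curly d x y) + brG (r x) (r y)
      - r (ract d x (r y)) - lact d x (r y) + r (ract d y (r x)) + lact d y (r x) \<and>
    curly d' (v x) (v y) = v (curly d x y) - v (ract d x (r y)) + v (ract d y (r x))"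
    if "x \<in> V" "y \<in> V" for x y
  proof -
    have "\<phi> (transported_bracket d x y) = transported_bracket d' (r x + v x) (r y + v y)"
      by (simp only: br \<phi>_V[of x] \<phi>_V[of y])
    then have "(cocyc d x y + r (curly d x y)) + v (curly d x y) =
      (brG (r x) (r y) + lact d' (v x) (r y) - lact d' (v y) (r x) + cocyc d' (v x) (v y))
      + (curly d' (v x) (v y) + ract d' (v x) (r y) - ract d' (v y) (r x))"
      using that by (simp add: \<phi> transported_bracket_sum transported_bracket_on)
    \<comment> \<open>As \<open>r x\<close> and \<open>r y\<close> lie in \<open>G\<close>, the
      formulas \<open>rv1\<close> express the mixed terms of \<open>d'\<close> through
      \<open>d\<close>; the two component equations are then solved for \<open>cocyc d'\<close> and
      \<open>curly d'\<close>.\<close>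
    from decomposition_unique[OF _ _ _ _ this] show ?thesis
      using that bracket_swap[of "r x" "r y"] by (simp add: rv1 algebra_simps)
  qed
  moreover have "op1 d' (v x) = op1 d x - PG (r x) + r (op2 d x) \<and> op2 d' (v x) = v (op2 d x)"
    if "x \<in> V" for x
  proof -
    have "\<phi> (transported_operator d x) = transported_operator d' (r x + v x)"
      by (simp only: P \<phi>_V[of x])
    then have "(op1 d x + r (op2 d x)) + v (op2 d x) = (PG (r x) + op1 d' (v x)) + op2 d' (v x)"
      using that by (simp add: \<phi> transported_operator_sum transported_operator_on)
    from decomposition_unique[OF _ _ _ _ this] show ?thesis
      using that by (simp add: algebra_simps)
  qed
  ultimately show "datum_morphism d d' (gpart \<circ> \<phi>) (vpart \<circ> \<phi>)"
    unfolding r_def[symmetric] v_def[symmetric] datum_morphism_def using rv1 by blast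
qed

section \<open>The relation on data as a pullback, and the bijection of quotients\<close>

text \<open>A pair \<open>r\<close>, \<open>v\<close> yields its shear, and an isomorphism fixing
  \<open>G\<close> yields the components of its restriction to \<open>V\<close>. With this
  description, reflexivity, symmetry and transitivity come from composing and inverting isomorphisms
  rather than from the formulas.\<close>

lemma datum_rel_eq:
  "datum_rel smul lam G brG PG V =
   {(d, d'). d \<in> extending_structures smul lam G brG PG V \<and>
     d' \<in> extending_structures smul lam G brG PG V \<and>
     (transported_structure G brG PG V d, transported_structure G brG PG V d')
       \<in> extd_rel smul lam G brG PG}"
proof -
  have "datum_equivalent smul G brG PG V d d' \<longleftrightarrow>
      (\<exists>\<phi>. rota_baxter_lie_iso smul UNIV (transported_bracket d) (transported_operator d)
        smul UNIV (transported_bracket d') (transported_operator d') \<phi> \<and> (\<forall>g\<in>G. \<phi> g = g))"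
    (is "_ \<longleftrightarrow> ?iso")
    if d: "d \<in> extending_data smul G V" and d': "d' \<in> extending_data smul G V" for d d'
  proof
    assume "datum_equivalent smul G brG PG V d d'"
    then obtain r v where r: "linear_on smul smul V G r" and v: "linear_on smul smul V V v"
      and bij: "bij_betw v V V" and rv: "datum_morphism d d' r v"
      unfolding datum_equivalent_iff by blast
    show ?iso
      \<comment> \<open>The shear fixes \<open>G\<close> because elements of \<open>G\<close> have
        \<open>V\<close> component 0 and both \<open>r\<close> and \<open>v\<close> send 0 to
        0.\<close>
      using hom_of_datum_morphism[OF d d' r v rv] bij_of_shear[OF r bij]
      by (intro exI[of _ "\<lambda>e. (gpart e + r (vpart e)) + v (vpart e)"])
        (auto simp: rota_baxter_lie_iso_def linear_on_zero[OF r] linear_on_zero[OF v])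
  next
    assume ?iso
    then show "datum_equivalent smul G brG PG V d d'"
      using datum_morphism_of_iso[OF d d'] unfolding datum_equivalent_iff by blast
  qed
  then show ?thesis
    using transported_structures
    by (auto simp: datum_rel_def extd_rel_def extending_structures_def case_prod_unfold)
qed

end

theorem theorem2p15:
  fixes smul :: "'k::field \<Rightarrow> 'e::ab_group_add \<Rightarrow> 'e"
    and lam :: 'k
    and G V :: "'e set"
    and brG :: "'e \<Rightarrow> 'e \<Rightarrow> 'e"
    and PG :: "'e \<Rightarrow> 'e"
  assumes "vector_space smul"
    and "rota_baxter_lie_algebra smul G brG lam PG"
    and "complement smul G V"
  shows "equiv (extending_structures smul lam G brG PG V) (datum_rel smul lam G brG PG V) \<and>
    unified_product_class smul lam G brG PG V respects datum_rel smul lam G brG PG V \<and>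
    (\<forall>d \<in> extending_structures smul lam G brG PG V.
       Phi smul lam G brG PG V (datum_rel smul lam G brG PG V `` {d}) =
       unified_product_class smul lam G brG PG V d) \<and>
    bij_betw (Phi smul lam G brG PG V) (H2 smul lam G brG PG V) (Extd smul lam G brG PG)"
proof -
  interpret rota_baxter_lie_algebra smul G brG lam PG
    by (rule assms(2))
  interpret rota_baxter_lie_extension smul G brG lam PG V
    by unfold_locales (rule assms(3))
  note E = equiv_extd_rel[of smul lam G brG PG]
  note T = transported_structures
  \<comment> \<open>The equivalence, the compatibility with representatives and the bijection are
    the three pullback lemmas for the map \<open>transported_structure\<close>, which sends
    extending structures onto the structures on E.\<close>
  have eqv: "equiv (extending_structures smul lam G brG PG V) (datum_rel smul lam G brG PG V)"
    by (rule equiv_pullback[OF E _ datum_rel_eq]) (simp add: T)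
  moreover have resp:
    "unified_product_class smul lam G brG PG V respects datum_rel smul lam G brG PG V"
    using respects_pullback[OF E datum_rel_eq] by (simp add: unified_product_class_def[abs_def])
  moreover have "\<forall>d \<in> extending_structures smul lam G brG PG V.
       Phi smul lam G brG PG V (datum_rel smul lam G brG PG V `` {d}) =
       unified_product_class smul lam G brG PG V d"
    unfolding Phi_def using UN_equiv_class[OF eqv resp] by blast
  moreover have
    "bij_betw (Phi smul lam G brG PG V) (H2 smul lam G brG PG V) (Extd smul lam G brG PG)"
    using bij_betw_quotient_pullback[OF E T datum_rel_eq]
    by (simp add: Phi_def[abs_def] H2_def Extd_def unified_product_class_def)
  ultimately show ?thesis
    by blast
qed

end
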